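(* Let $D$ be a $t$-partite degree matrix which is a subdegree matrix for a (possibly infinite, locally finite) graph $G$, let $T_D$ be the universal cover tree of $D$, and let $\pi:T_D\to G$ be a subuniversal projection. Let $v\in V(G)$ and let $s\in V(T_D)$ with $\pi(s)=v$. Then for every integer $r\ge0$, $\rho(G_r(v))\ge\rho(T_{D,r}(s))$, where $G_r(v)$ and $T_{D,r}(s)$ denote the $r$-balls around $v$ in $G$ and around $s$ in $T_D$, respectively.
   Context: A $t$-partite degree matrix ($t\ge1$) is a square matrix $D=[d_{ij}]_{i,j=1}^t$ with non-negative integer entries satisfying: (D1) if $d_{ij}=0$ then $d_{ji}=0$; (D2) for all $i,k$ there are $m_1=i,\dots,m_s=k$ with $d_{m_jm_{j+1}}>0$ for all $j$; (D3) for every sequence of distinct $m_1,\dots,m_s$, $d_{m_1m_2}\cdots d_{m_{s-1}m_s}d_{m_sm_1}=d_{m_1m_s}d_{m_sm_{s-1}}\cdots d_{m_2m_1}$. $D$ is a degree matrix for a graph $H$ if $V(H)$ has a partition $U_1\cup\cdots\cup U_t$ such that every vertex in $U_i$ has exactly $d_{ij}$ neighbors in $U_j$ for all $i,j$. The universal cover $T_D$ is the (unique up to isomorphism) tree having $D$ as its degree matrix. $D$ is a subdegree matrix for $G$ if there is a graph homomorphism $\pi:T_D\to G$ (a subuniversal projection) that is locally 1-1, i.e. for each vertex $x\in V(T_D)$, $\pi$ maps the edges incident with $x$ injectively to the edges incident with $\pi(x)$. The $r$-ball $H_r(u)$ around a vertex $u$ of a graph $H$ is the induced subgraph on the vertices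 at distance at most $r$ from $u$ (finite, as graphs are locally finite). $\rho(\cdot)$ denotes the largest eigenvalue of the adjacency matrix of a finite graph. *)

theory Defs
  imports
    "HOL-Library.Disjoint_Sets"
    "Graph_Theory.Graph_Theory"
    "Jordan_Normal_Form.Spectral_Radius"
begin

text \<open>
  A (simple, undirected, possibly infinite) graph is a \<^locale>\<open>pair_bidirected_digraph\<close>: a symmetric,
  irreflexive set of arcs, an edge \<open>xy\<close> being the pair of opposite arcs \<open>(x,y)\<close>, \<open>(y,x)\<close>.
\<close>

definition locally_finite_graph :: "'a pair_pre_digraph \<Rightarrow> bool" where
  "locally_finite_graph G \<longleftrightarrow>
     pair_bidirected_digraph G \<and> (\<forall>x\<in>pverts G. finite (out_arcs (with_proj G) x))"

text \<open>
  \<^const>\<open>tree\<close> is a notion for digraphs: it counts \<open>x,y,x\<close> as a cycle. The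
  cycles of an undirected graph are the directed ones of length at least 3.
\<close>
definition undirected_tree :: "'a pair_pre_digraph \<Rightarrow> bool" where
  "undirected_tree T \<longleftrightarrow>
     pair_bidirected_digraph T \<and> Digraph_Component.connected (with_proj T) \<and>
     \<not> (\<exists>p. pre_digraph.cycle (with_proj T) p \<and> 3 \<le> length p)"

text \<open>
  The indices \<open>1,\<dots>,t\<close> are shifted to \<open>0,\<dots>,t-1\<close>.
  In the last conjunct a cyclic product is compared with the one in reverse direction.\<close>
definition degree_matrix :: "nat \<Rightarrow> nat mat \<Rightarrow> bool" where
  "degree_matrix t D \<longleftrightarrow>
     1 \<le> t \<and> D \<in> carrier_mat t t \<and>
     (\<forall>i<t. \<forall>j<t. D $$ (i, j) = 0 \<longrightarrow> D $$ (j, i) = 0) \<and>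
     (\<forall>i<t. \<forall>k<t. \<exists>ms. ms \<noteq> [] \<and> set ms \<subseteq> {..<t} \<and> hd ms = i \<and> last ms = k \<and>
        (\<forall>j. Suc j < length ms \<longrightarrow> 0 < D $$ (ms ! j, ms ! Suc j))) \<and>
     (\<forall>ms. ms \<noteq> [] \<and> set ms \<subseteq> {..<t} \<and> distinct ms \<longrightarrow>
        (\<Prod>j<length ms. D $$ (ms ! j, ms ! (Suc j mod length ms))) =
        (\<Prod>j<length ms. D $$ (ms ! (Suc j mod length ms), ms ! j)))"

text \<open>Finiteness is required explicitly because \<^const>\<open>card\<close> is 0 on infinite sets.\<close>
definition degree_matrix_for :: "nat \<Rightarrow> nat mat \<Rightarrow> 'a pair_pre_digraph \<Rightarrow> bool" where
  "degree_matrix_for t D H \<longleftrightarrow>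
     degree_matrix t D \<and>
     (\<exists>U :: nat \<Rightarrow> 'a set.
        (\<Union>i<t. U i) = pverts H \<and> disjoint_family_on U {..<t} \<and> (\<forall>i<t. U i \<noteq> {}) \<and>
        (\<forall>i<t. \<forall>j<t. \<forall>x\<in>U i.
           finite {y \<in> U j. (x, y) \<in> parcs H} \<and> card {y \<in> U j. (x, y) \<in> parcs H} = D $$ (i, j)))"

definition universal_cover :: "nat \<Rightarrow> nat mat \<Rightarrow> 'a pair_pre_digraph \<Rightarrow> bool" where
  "universal_cover t D T \<longleftrightarrow> undirected_tree T \<and> degree_matrix_for t D T"

definition graph_hom :: "('b \<Rightarrow> 'a) \<Rightarrow> 'b pair_pre_digraph \<Rightarrow> 'a pair_pre_digraph \<Rightarrow> bool" where
  "graph_hom \<pi> T G \<longleftrightarrow>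
     (\<forall>x\<in>pverts T. \<pi> x \<in> pverts G) \<and> (\<forall>(x, y)\<in>parcs T. (\<pi> x, \<pi> y) \<in> parcs G)"

text \<open>The edges incident with \<open>x\<close> are represented by the arcs with tail \<open>x\<close>.\<close>
definition subuniversal_projection ::
    "('b \<Rightarrow> 'a) \<Rightarrow> 'b pair_pre_digraph \<Rightarrow> 'a pair_pre_digraph \<Rightarrow> bool" where
  "subuniversal_projection \<pi> T G \<longleftrightarrow>
     graph_hom \<pi> T G \<and> (\<forall>x\<in>pverts T. inj_on (map_prod \<pi> \<pi>) (out_arcs (with_proj T) x))"

text \<open>
  The universal cover is unique up to isomorphism and, being connected and locally finite, countable;
  so it has a copy with vertices in \<^typ>\<open>nat\<close>, and nothing is lost by quantifying over these only.
\<close>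
definition subdegree_matrix :: "nat \<Rightarrow> nat mat \<Rightarrow> 'a pair_pre_digraph \<Rightarrow> bool" where
  "subdegree_matrix t D G \<longleftrightarrow>
     degree_matrix t D \<and>
     (\<exists>(T :: nat pair_pre_digraph) \<pi>. universal_cover t D T \<and> subuniversal_projection \<pi> T G)"

definition graph_dist :: "'a pair_pre_digraph \<Rightarrow> 'a \<Rightarrow> 'a \<Rightarrow> ereal" where
  "graph_dist G = wf_digraph.\<mu> (with_proj G) (\<lambda>_. 1)"

definition ball_graph :: "'a pair_pre_digraph \<Rightarrow> nat \<Rightarrow> 'a \<Rightarrow> ('a, 'a \<times> 'a) pre_digraph" where
  "ball_graph G r v = with_proj G \<restriction> {u \<in> pverts G. graph_dist G v u \<le> ereal (real r)}"

definition adjacency_matrix :: "('a, 'b) pre_digraph \<Rightarrow> 'a list \<Rightarrow> real mat" where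
  "adjacency_matrix H vs =
     mat (length vs) (length vs) (\<lambda>(i, j). if vs ! i \<rightarrow>\<^bsub>H\<^esub> vs ! j then 1 else 0)"

text \<open>
  The largest eigenvalue of a finite graph. Reordering the vertices permutes rows and columns of the
  adjacency matrix simultaneously, so the chosen enumeration is immaterial. All eigenvalues of the
  matrix are real since it is symmetric.
\<close>
definition graph_rho :: "('a, 'b) pre_digraph \<Rightarrow> real" where
  "graph_rho H =
     Max (spectrum (adjacency_matrix H (SOME vs. distinct vs \<and> set vs = verts H)))"

end

theory Submission
  imports Defs "HOL-Analysis.Convex"
begin

text \<open>
  Push a vector \<open>f\<close> on the ball of \<open>T\<close> forward to the vector \<open>g u = sqrt (\<Sum>x\<in>\<pi>\<^sup>-\<^sup>1 u. (f x)\<^sup>2)\<close> on the ball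
  of \<open>G\<close>, which has the same Euclidean norm. Local injectivity says that the arcs over an arc \<open>uw\<close>
  form a partial matching between the fibres of \<open>u\<close> and \<open>w\<close>, so by Cauchy--Schwarz they contribute
  at most \<open>g u * g w\<close> to the quadratic form of the adjacency matrix. Hence the Rayleigh quotient of
  \<open>g\<close> is at least that of \<open>f\<close>.
\<close>

unbundle no inner_syntax

section \<open>Rayleigh quotients of real symmetric matrices\<close>

lemma scalar_prod_self_nonneg: "(0::real) \<le> v \<bullet> v"
  by (auto simp: scalar_prod_def intro: sum_nonneg)

lemma mult_mat_vec_bounded:
  fixes A :: "real mat"
  assumes A: "A \<in> carrier_mat m n"
  obtains C where "C > 0" "\<And>x. x \<in> carrier_vec n \<Longrightarrow> (A *\<^sub>v x) \<bullet> (A *\<^sub>v x) \<le> C * (x \<bullet> x)"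
proof
  \<comment> \<open>The sum is the squared Frobenius norm, coming from Cauchy--Schwarz applied to
    each row. The summand 1 keeps the constant positive even for a zero matrix, so that it can later
    be divided by.\<close>
  let ?C = "1 + (\<Sum>i<m. row A i \<bullet> row A i)"
  show "?C > 0" by (smt (verit) scalar_prod_self_nonneg sum_nonneg)
  fix x :: "real vec" assume x: "x \<in> carrier_vec n"
  have CS: "(row A i \<bullet> x)\<^sup>2 \<le> (row A i \<bullet> row A i) * (x \<bullet> x)" if "i < m" for i
    using Cauchy_Schwarz_ineq_sum[of "\<lambda>j. row A i $ j" "\<lambda>j. x $ j" "{0..<n}"] A x that
    by (simp add: scalar_prod_def power2_eq_square)
  have "(A *\<^sub>v x) \<bullet> (A *\<^sub>v x) = (\<Sum>i<m. (row A i \<bullet> x)\<^sup>2)"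
    using A by (simp add: scalar_prod_def[of "A *\<^sub>v x"] power2_eq_square atLeast0LessThan)
  also have "\<dots> \<le> (\<Sum>i<m. (row A i \<bullet> row A i) * (x \<bullet> x))"
    by (intro sum_mono CS) auto
  also have "\<dots> = (\<Sum>i<m. row A i \<bullet> row A i) * (x \<bullet> x)"
    by (simp add: sum_distrib_right)
  also have "\<dots> \<le> ?C * (x \<bullet> x)"
    using scalar_prod_self_nonneg[of x] by (simp add: distrib_right)
  finally show "(A *\<^sub>v x) \<bullet> (A *\<^sub>v x) \<le> ?C * (x \<bullet> x)" .
qed

lemma smult_one_mat_mult_vec:
  fixes x :: "'a :: comm_ring_1 vec"
  shows "x \<in> carrier_vec n \<Longrightarrow> (c \<cdot>\<^sub>m 1\<^sub>m n) *\<^sub>v x = c \<cdot>\<^sub>v x"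
  by (intro eq_vecI) auto

text \<open>
  If the supremum \<open>l\<close> were no eigenvalue, \<open>P = A - l\<close> would be invertible; negative semidefiniteness,
  tested at \<open>x + t P x\<close> for a small \<open>t > 0\<close>, would then bound \<open>x \<bullet> P x\<close> away from 0 on the unit
  sphere. This avoids a compactness argument, as vectors here carry no topology.
\<close>
lemma Rayleigh_sup_attained:
  fixes A :: "real mat"
  assumes A: "A \<in> carrier_mat n n" and sym: "transpose_mat A = A" and "n > 0"
  obtains l where "eigenvalue A l" "\<And>x. x \<in> carrier_vec n \<Longrightarrow> x \<bullet> (A *\<^sub>v x) \<le> l * (x \<bullet> x)"
proof -
  define S where "S = {x \<bullet> (A *\<^sub>v x) | x. x \<in> carrier_vec n \<and> x \<bullet> x = 1}"
  define l where "l = Sup S"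
  define P where "P = char_matrix A l"
  have P: "P \<in> carrier_mat n n" using A by (simp add: P_def)
  obtain CA where CA: "\<And>x. x \<in> carrier_vec n \<Longrightarrow> (A *\<^sub>v x) \<bullet> (A *\<^sub>v x) \<le> CA * (x \<bullet> x)"
    using mult_mat_vec_bounded[OF A] by blast
  \<comment> \<open>Taken at \<open>y = A *\<^sub>v x\<close> this bounds the quadratic form on the
    unit sphere, whence \<open>S\<close> is bounded above.\<close>
  have young: "2 * (x \<bullet> y) \<le> x \<bullet> x + y \<bullet> y" if "x \<in> carrier_vec n" "y \<in> carrier_vec n" for x y :: "real vec"
  proof -
    have "0 \<le> (x - y) \<bullet> (x - y)" by (rule scalar_prod_self_nonneg)
    also have "\<dots> = x \<bullet> x + y \<bullet> y - 2 * (x \<bullet> y)"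
      using that
      by (simp add: minus_scalar_prod_distrib[of _ n] scalar_prod_minus_distrib[of _ n]
          comm_scalar_prod[of y n x])
    finally show ?thesis by simp
  qed
  have bdd: "bdd_above S"
  proof (rule bdd_aboveI)
    fix a assume "a \<in> S"
    then obtain x where x: "x \<in> carrier_vec n" "x \<bullet> x = 1" "a = x \<bullet> (A *\<^sub>v x)" by (auto simp: S_def)
    show "a \<le> (1 + CA) / 2" using young[OF x(1), of "A *\<^sub>v x"] CA[OF x(1)] x A by simp
  qed
  \<comment> \<open>This is where \<open>n > 0\<close> enters: \<open>S\<close> is nonempty, so
    \<open>Sup S\<close> is a true least upper bound and not an unspecified real.\<close>
  have "unit_vec n 0 \<bullet> (A *\<^sub>v unit_vec n 0) \<in> S"
    using \<open>n > 0\<close> by (auto simp: S_def intro!: exI[of _ "unit_vec n 0"])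
  hence ne: "S \<noteq> {}" by blast
  \<comment> \<open>Both sides are homogeneous of degree 2, so a bound on the unit sphere extends to
    all vectors after normalizing by \<open>k\<close>.\<close>
  have scale: "x \<bullet> (A *\<^sub>v x) \<le> c * (x \<bullet> x)"
    if x: "x \<in> carrier_vec n" and c: "\<And>a. a \<in> S \<Longrightarrow> a \<le> c" for x c
  proof (cases "x = 0\<^sub>v n")
    case True
    then show ?thesis using A by simp
  next
    case False
    then obtain i where i: "i < n" "x $ i \<noteq> 0" using x by (metis carrier_vecD eq_vecI index_zero_vec)
    have "0 < (\<Sum>i = 0..<n. x $ i * x $ i)"
      by (rule sum_pos2[of _ i]) (use i in \<open>auto simp: zero_less_mult_iff\<close>)
    hence pos: "x \<bullet> x > 0" using x by (simp add: scalar_prod_def)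
    define k where "k = 1 / sqrt (x \<bullet> x)"
    have k: "k * k * (x \<bullet> x) = 1" using pos by (simp add: k_def)
    have "(k \<cdot>\<^sub>v x) \<bullet> (A *\<^sub>v (k \<cdot>\<^sub>v x)) = k * k * (x \<bullet> (A *\<^sub>v x))"
      using x A by (simp add: mult_mat_vec[OF A x])
    moreover have "(k \<cdot>\<^sub>v x) \<bullet> (k \<cdot>\<^sub>v x) = 1" using x k by simp
    ultimately have "k * k * (x \<bullet> (A *\<^sub>v x)) \<in> S"
      using x unfolding S_def by (metis (mono_tags, lifting) mem_Collect_eq smult_carrier_vec)
    hence "k * k * (x \<bullet> (A *\<^sub>v x)) \<le> c * (k * k * (x \<bullet> x))" using c k by simp
    hence "k * k * (x \<bullet> (A *\<^sub>v x)) \<le> k * k * (c * (x \<bullet> x))" by (simp add: mult_ac)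
    moreover have "k * k > 0" using pos by (simp add: k_def)
    ultimately show ?thesis by (simp add: mult_le_cancel_left_pos)
  qed
  have upper: "x \<bullet> (A *\<^sub>v x) \<le> l * (x \<bullet> x)" if "x \<in> carrier_vec n" for x
    using scale[OF that] cSup_upper[OF _ bdd] by (simp add: l_def)
  have Pv: "P *\<^sub>v x = A *\<^sub>v x + (-l) \<cdot>\<^sub>v x" if "x \<in> carrier_vec n" for x
    using A that
    by (simp add: smult_one_mat_mult_vec P_def char_matrix_def add_mult_distrib_mat_vec[of _ n n])
  have Pq: "x \<bullet> (P *\<^sub>v y) = x \<bullet> (A *\<^sub>v y) - l * (x \<bullet> y)"
    if "x \<in> carrier_vec n" "y \<in> carrier_vec n" for x y
    using A that by (simp add: Pv scalar_prod_add_distrib[of _ n])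
  have Asym: "x \<bullet> (A *\<^sub>v y) = y \<bullet> (A *\<^sub>v x)" if "x \<in> carrier_vec n" "y \<in> carrier_vec n" for x y
    using transpose_vec_mult_scalar[OF A that(2) that(1)] A that
    by (simp add: sym comm_scalar_prod[of "A *\<^sub>v x" n])
  have "eigenvalue A l"
  proof (rule ccontr)
    assume "\<not> eigenvalue A l"
    hence "det P \<noteq> 0" using eigenvalue_det[OF A] by (simp add: P_def)
    from det_non_zero_imp_unit[OF P this, where b = "()"]
    obtain N where N: "N \<in> carrier_mat n n" "N * P = 1\<^sub>m n"
      by (auto simp: Units_def ring_mat_def)
    \<comment> \<open>\<open>K\<close> controls the inverse \<open>N\<close>, so
      \<open>P *\<^sub>v x\<close> cannot be short compared with \<open>x\<close>; \<open>C\<close>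
      controls \<open>P\<close> itself and fixes the step length \<open>t\<close> below.\<close>
    obtain K where K: "K > 0" "\<And>x. x \<in> carrier_vec n \<Longrightarrow> (N *\<^sub>v x) \<bullet> (N *\<^sub>v x) \<le> K * (x \<bullet> x)"
      using mult_mat_vec_bounded[OF N(1)] by blast
    obtain C where C: "C > 0" "\<And>x. x \<in> carrier_vec n \<Longrightarrow> (P *\<^sub>v x) \<bullet> (P *\<^sub>v x) \<le> C * (x \<bullet> x)"
      using mult_mat_vec_bounded[OF P] by blast
    have gap: "x \<bullet> (P *\<^sub>v x) \<le> - (x \<bullet> x) / (K * (C + 1))" if x: "x \<in> carrier_vec n" for x
    proof -
      define z where "z = P *\<^sub>v x"
      have z: "z \<in> carrier_vec n" using mult_mat_vec_carrier[OF P x] by (simp add: z_def)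
      have "N *\<^sub>v z = x" using N P x by (simp add: z_def flip: assoc_mult_mat_vec)
      hence xz: "x \<bullet> x \<le> K * (z \<bullet> z)" using K(2)[OF z] by simp
      \<comment> \<open>Expanding a square bounds twice the left side; as the left side is
        nonnegative by semidefiniteness, the factor 2 may be dropped.\<close>
      have zz: "- (z \<bullet> (P *\<^sub>v z)) \<le> (C + 1) * (z \<bullet> z)"
      proof -
        have "0 \<le> (z + P *\<^sub>v z) \<bullet> (z + P *\<^sub>v z)" by (rule scalar_prod_self_nonneg)
        also have "\<dots> = z \<bullet> z + (P *\<^sub>v z) \<bullet> (P *\<^sub>v z) + 2 * (z \<bullet> (P *\<^sub>v z))"
          using z P by (simp add: add_scalar_prod_distrib[of _ n] scalar_prod_add_distrib[of _ n]
              comm_scalar_prod[of "P *\<^sub>v z" n z])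
        finally have "- 2 * (z \<bullet> (P *\<^sub>v z)) \<le> (C + 1) * (z \<bullet> z)"
          using C(2)[OF z] by (simp add: algebra_simps)
        moreover have "z \<bullet> (P *\<^sub>v z) \<le> 0" using upper[OF z] Pq[OF z z] by simp
        ultimately show ?thesis by simp
      qed
      \<comment> \<open>This \<open>t\<close> maximizes \<open>2 * t - (C + 1) * t * t\<close>, the
        coefficient of \<open>z \<bullet> z\<close> left after \<open>zz\<close> is inserted into
        the form at \<open>w\<close>. The maximum is again \<open>1 / (C + 1)\<close>.\<close>
      define t where "t = 1 / (C + 1)"
      have t: "t > 0" "t * (C + 1) = 1" using C(1) by (auto simp: t_def)
      define w where "w = x + t \<cdot>\<^sub>v z"
      have w: "w \<in> carrier_vec n" using x z by (simp add: w_def)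
      have Pw: "P *\<^sub>v w = z + t \<cdot>\<^sub>v (P *\<^sub>v z)"
        using x z P by (simp add: w_def z_def mult_add_distrib_mat_vec[of _ n n] mult_mat_vec[of _ n n])
      \<comment> \<open>\<open>P\<close> inherits symmetry from \<open>A\<close>, so
        \<open>P\<close> moves to the other factor and turns \<open>x\<close> into
        \<open>z\<close>.\<close>
      have xPz: "x \<bullet> (P *\<^sub>v z) = z \<bullet> z"
        using Pq[OF x z] Pq[OF z x] Asym[OF x z] x z by (simp add: comm_scalar_prod[of x n z] flip: z_def)
      have "w \<bullet> (P *\<^sub>v w) = x \<bullet> z + 2 * t * (z \<bullet> z) + t * t * (z \<bullet> (P *\<^sub>v z))"
        unfolding Pw unfolding w_def using x z P
        by (simp add: add_scalar_prod_distrib[of _ n] scalar_prod_add_distrib[of _ n] xPz algebra_simps)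
      moreover have "w \<bullet> (P *\<^sub>v w) \<le> 0" using upper[OF w] Pq[OF w w] by simp
      moreover have "t * t * (- (z \<bullet> (P *\<^sub>v z))) \<le> t * t * ((C + 1) * (z \<bullet> z))"
        using zz t by (intro mult_left_mono) auto
      moreover have "t * t * ((C + 1) * (z \<bullet> z)) = t * (z \<bullet> z)" using t(2) by (simp add: mult_ac)
      ultimately have "x \<bullet> z \<le> - t * (z \<bullet> z)" by (simp add: algebra_simps)
      also have "\<dots> \<le> - t * ((x \<bullet> x) / K)"
        using xz t K(1) by (simp add: field_simps)
      finally show ?thesis by (simp add: z_def t_def mult_ac)
    qed
    \<comment> \<open>By \<open>gap\<close> all of \<open>S\<close> stays below \<open>l\<close> by
      a fixed amount, which contradicts that \<open>l\<close> is its least upper bound.\<close>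
    have "a \<le> l - 1 / (K * (C + 1))" if "a \<in> S" for a
    proof -
      from that obtain x where x: "x \<in> carrier_vec n" "x \<bullet> x = 1" "a = x \<bullet> (A *\<^sub>v x)" by (auto simp: S_def)
      show ?thesis using gap[OF x(1)] Pq[OF x(1) x(1)] x by simp
    qed
    hence "l \<le> l - 1 / (K * (C + 1))" unfolding l_def by (intro cSup_least ne) 
    moreover have "1 / (K * (C + 1)) > 0" using K C by simp
    ultimately show False by simp
  qed
  with upper show ?thesis by (rule that[rotated])
qed

text \<open>The eigenvalue from \<open>Rayleigh_sup_attained\<close> shows that the finite real
  spectrum is nonempty, so its \<open>Max\<close> is a genuine eigenvalue. It is at least that
  eigenvalue, and the Rayleigh bound only weakens when the factor of the nonnegative
  \<open>x \<bullet> x\<close> grows.\<close>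

lemma Max_spectrum_symmetric:
  fixes A :: "real mat"
  assumes A: "A \<in> carrier_mat n n" and "transpose_mat A = A" and "n > 0"
  shows Max_spectrum_eigenvalue: "eigenvalue A (Max (spectrum A))"
    and Rayleigh_le_Max_spectrum: "x \<in> carrier_vec n \<Longrightarrow> x \<bullet> (A *\<^sub>v x) \<le> Max (spectrum A) * (x \<bullet> x)"
proof -
  obtain l where l: "eigenvalue A l" "\<And>x. x \<in> carrier_vec n \<Longrightarrow> x \<bullet> (A *\<^sub>v x) \<le> l * (x \<bullet> x)"
    using Rayleigh_sup_attained[OF assms] by blast
  have fin: "finite (spectrum A)" by (rule card_finite_spectrum[OF A])
  have mem: "l \<in> spectrum A" using l by (simp add: spectrum_def)
  show "eigenvalue A (Max (spectrum A))" using Max_in[OF fin] mem by (auto simp: spectrum_def)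
  show "x \<bullet> (A *\<^sub>v x) \<le> Max (spectrum A) * (x \<bullet> x)" if "x \<in> carrier_vec n"
    using l(2)[OF that] mult_right_mono[OF Max_ge[OF fin mem] scalar_prod_self_nonneg[of x]] by simp
qed

section \<open>The largest eigenvalue of a finite graph as a maximal Rayleigh quotient\<close>

lemma sum_nth_distinct: "distinct xs \<Longrightarrow> (\<Sum>i<length xs. f (xs ! i)) = sum f (set xs)"
  by (rule sum.reindex_bij_betw) (simp add: bij_betw_nth)

text \<open>The quadratic form of the adjacency matrix, free of any enumeration of the vertices. It
  runs over ordered pairs, so an undirected edge counts twice.\<close>

definition arc_form :: "('a, 'b) pre_digraph \<Rightarrow> ('a \<Rightarrow> real) \<Rightarrow> real" where
  "arc_form H f = (\<Sum>u\<in>verts H. \<Sum>w\<in>verts H. if u \<rightarrow>\<^bsub>H\<^esub> w then f u * f w else 0)"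

lemma adjacency_matrix_form:
  assumes "distinct vs" "set vs = verts H"
  shows "vec (length vs) (\<lambda>i. f (vs ! i)) \<bullet>
      (adjacency_matrix H vs *\<^sub>v vec (length vs) (\<lambda>i. f (vs ! i))) = arc_form H f"
proof -
  have "arc_form H f = (\<Sum>i<length vs. \<Sum>j<length vs.
      if vs ! i \<rightarrow>\<^bsub>H\<^esub> vs ! j then f (vs ! i) * f (vs ! j) else 0)"
    by (simp only: arc_form_def assms(2)[symmetric] sum_nth_distinct[OF assms(1), symmetric])
  thus ?thesis
    by (simp add: scalar_prod_def adjacency_matrix_def atLeast0LessThan sum_distrib_left
        if_distrib if_distribR cong: if_cong)
qed

text \<open>Translates the matrix facts into statements about functions on vertices. These two
  properties are all that the later comparison uses of \<open>graph_rho\<close>; the chosen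
  enumeration and the matrix do not appear again.\<close>

lemma graph_rho_Rayleigh:
  fixes H :: "('a, 'b) pre_digraph"
  assumes fin: "finite (verts H)" and ne: "verts H \<noteq> {}"
    and sym: "\<And>u w. u \<rightarrow>\<^bsub>H\<^esub> w \<Longrightarrow> w \<rightarrow>\<^bsub>H\<^esub> u"
  shows graph_rho_attained:
      "\<exists>f. 0 < (\<Sum>u\<in>verts H. (f u)\<^sup>2) \<and> arc_form H f = graph_rho H * (\<Sum>u\<in>verts H. (f u)\<^sup>2)"
    and arc_form_le_graph_rho: "arc_form H g \<le> graph_rho H * (\<Sum>u\<in>verts H. (g u)\<^sup>2)"
proof -
  define vs where "vs = (SOME vs. distinct vs \<and> set vs = verts H)"
  have "\<exists>vs. distinct vs \<and> set vs = verts H" using finite_distinct_list[OF fin] by blast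
  from someI_ex[OF this] have vs: "distinct vs" "set vs = verts H" by (auto simp: vs_def)
  define n where "n = length vs"
  define A where "A = adjacency_matrix H vs"
  have A: "A \<in> carrier_mat n n" by (simp add: A_def adjacency_matrix_def n_def)
  have tr: "transpose_mat A = A"
    using sym by (intro eq_matI) (auto simp: A_def adjacency_matrix_def)
  have n: "n > 0" using vs ne by (auto simp: n_def)
  have rho: "graph_rho H = Max (spectrum A)" by (simp add: graph_rho_def A_def vs_def)
  have norm: "vec n (\<lambda>i. h (vs ! i)) \<bullet> vec n (\<lambda>i. h (vs ! i)) = (\<Sum>u\<in>verts H. (h u)\<^sup>2)" for h :: "'a \<Rightarrow> real"
    using sum_nth_distinct[OF vs(1), of "\<lambda>u. (h u)\<^sup>2"]
    by (simp add: scalar_prod_def n_def vs power2_eq_square atLeast0LessThan)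
  note form = adjacency_matrix_form[OF vs, folded n_def A_def]
  show "arc_form H g \<le> graph_rho H * (\<Sum>u\<in>verts H. (g u)\<^sup>2)"
    using Rayleigh_le_Max_spectrum[OF A tr n, of "vec n (\<lambda>i. g (vs ! i))"]
    by (simp add: norm form rho)
  obtain x where x: "x \<in> carrier_vec n" "x \<noteq> 0\<^sub>v n" "A *\<^sub>v x = graph_rho H \<cdot>\<^sub>v x"
    using Max_spectrum_eigenvalue[OF A tr n] A by (auto simp: rho eigenvalue_def eigenvector_def)
  have inj: "inj_on ((!) vs) {..<n}" using vs(1) by (simp add: n_def inj_on_nth)
  \<comment> \<open>The eigenvector is read as a function on vertices by inverting the enumeration,
    which is injective as \<open>vs\<close> is distinct. Values outside \<open>verts H\<close> are
    arbitrary and never enter the sums.\<close>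
  define f where "f u = x $ (the_inv_into {..<n} ((!) vs) u)" for u
  have fx: "vec n (\<lambda>i. f (vs ! i)) = x"
    using x(1) by (intro eq_vecI) (auto simp: f_def the_inv_into_f_f[OF inj])
  obtain i where i: "i < n" "x $ i \<noteq> 0" using x by (metis carrier_vecD eq_vecI index_zero_vec)
  have "0 < (\<Sum>i = 0..<n. x $ i * x $ i)"
    by (rule sum_pos2[of _ i]) (use i in \<open>auto simp: zero_less_mult_iff\<close>)
  hence "0 < x \<bullet> x" using x(1) by (simp add: scalar_prod_def)
  moreover have "x \<bullet> (A *\<^sub>v x) = graph_rho H * (x \<bullet> x)" using x by simp
  ultimately show "\<exists>f. 0 < (\<Sum>u\<in>verts H. (f u)\<^sup>2) \<and> arc_form H f = graph_rho H * (\<Sum>u\<in>verts H. (f u)\<^sup>2)"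
    using norm[of f] form[of f] unfolding fx by auto
qed


section \<open>Balls described by powers of the arc relation, and their finiteness\<close>

lemma (in pair_wf_digraph) awalk_length_relpow:
  "v \<in> pverts G \<Longrightarrow> (\<exists>p. awalk v p u \<and> length p = n) \<longleftrightarrow> (v, u) \<in> parcs G ^^ n"
proof (induction n arbitrary: v)
  \<comment> \<open>The empty walk must start at a vertex, whereas the zeroth relational power is
    the identity on the whole type; the assumption on \<open>v\<close> reconciles the two.\<close>
  case 0
  then show ?case by (auto simp: awalk_Nil_iff)
next
  case (Suc n)
  have "(\<exists>p. awalk v p u \<and> length p = Suc n) \<longleftrightarrow>
      (\<exists>w. (v, w) \<in> parcs G \<and> (\<exists>p. awalk w p u \<and> length p = n))"
    by (fastforce simp: length_Suc_conv awalk_Cons_iff intro: exI[of _ "_ # _"])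
  also have "\<dots> \<longleftrightarrow> (\<exists>w. (v, w) \<in> parcs G \<and> (w, u) \<in> parcs G ^^ n)"
    using Suc.IH by (metis in_arcsD2)
  also have "\<dots> \<longleftrightarrow> (v, u) \<in> parcs G ^^ Suc n"
    by (meson relpow_Suc_D2 relpow_Suc_I2)
  finally show ?case .
qed

lemma (in pair_wf_digraph) graph_dist_le_iff:
  assumes "v \<in> pverts G"
  shows "graph_dist G v u \<le> ereal (real r) \<longleftrightarrow> (\<exists>n\<le>r. (v, u) \<in> parcs G ^^ n)"
proof -
  have cost: "awalk_cost (\<lambda>_. 1) p = real (length p)" for p :: "('a \<times> 'a) list"
    by (simp add: awalk_cost_def sum_list_triv)
  have "graph_dist G v u \<le> ereal (real r) \<longleftrightarrow> (\<exists>p. awalk v p u \<and> length p \<le> r)"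
  proof
    assume "graph_dist G v u \<le> ereal (real r)"
    \<comment> \<open>The distance is an infimum, and only a strict bound on it yields a walk.
      Lengths being integers, a walk shorter than \<open>r + 1\<close> has length at most
      \<open>r\<close>.\<close>
    hence "graph_dist G v u < ereal (real r + 1)" by (rule order_le_less_trans) simp
    then obtain p where "awalk v p u" "real (length p) < real r + 1"
      by (auto simp: graph_dist_def \<mu>_def INF_less_iff cost)
    thus "\<exists>p. awalk v p u \<and> length p \<le> r" by (intro exI[of _ p]) auto
  next
    assume "\<exists>p. awalk v p u \<and> length p \<le> r"
    then obtain p where p: "awalk v p u" "length p \<le> r" by blast
    show "graph_dist G v u \<le> ereal (real r)"
      using min_cost_le_walk_cost[OF p(1), of "\<lambda>_. 1"] p(2)
      by (auto simp: graph_dist_def cost intro: order_trans)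
  qed
  also have "\<dots> \<longleftrightarrow> (\<exists>n\<le>r. \<exists>p. awalk v p u \<and> length p = n)" by auto
  finally show ?thesis using awalk_length_relpow[OF assms] by simp
qed

lemma (in pair_wf_digraph) verts_ball_graph:
  assumes "v \<in> pverts G"
  shows "verts (ball_graph G r v) = {u. \<exists>n\<le>r. (v, u) \<in> parcs G ^^ n}"
proof -
  have "u \<in> pverts G" if "(v, u) \<in> parcs G ^^ n" for u n
    using that assms by (cases n) (auto dest: in_arcsD2)
  thus ?thesis by (auto simp: ball_graph_def graph_dist_le_iff[OF assms])
qed

lemma arc_ball_graph_iff:
  "u \<rightarrow>\<^bsub>ball_graph G r v\<^esub> w \<longleftrightarrow>
     (u, w) \<in> parcs G \<and> u \<in> verts (ball_graph G r v) \<and> w \<in> verts (ball_graph G r v)"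
  by (force simp: ball_graph_def arcs_ends_def arc_to_ends_def)

lemma finite_relpow_Image:
  fixes R :: "'a rel"
  assumes "\<And>x. finite (R `` {x})"
  shows "finite ((R ^^ n) `` {x})"
proof (induction n)
  case (Suc n)
  have "(R ^^ Suc n) `` {x} = (\<Union>y\<in>(R ^^ n) `` {x}. R `` {y})" by auto
  thus ?case using Suc assms by simp
qed simp

lemma (in pair_wf_digraph) finite_ball_graph:
  assumes "v \<in> pverts G" and fin: "\<And>x. x \<in> pverts G \<Longrightarrow> finite {y. (x, y) \<in> parcs G}"
  shows "finite (verts (ball_graph G r v))"
proof -
  \<comment> \<open>\<open>finite_relpow_Image\<close> asks for finiteness at every point of the
    type; no arc leaves a point outside \<open>pverts G\<close>.\<close>
  have "finite (parcs G `` {x})" for x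
  proof (cases "x \<in> pverts G")
    case True
    thus ?thesis using fin[OF True] by (simp add: Image_def)
  next
    case False
    hence "parcs G `` {x} = {}" by (auto dest: in_arcsD1)
    thus ?thesis by simp
  qed
  hence "finite (\<Union>n\<le>r. (parcs G ^^ n) `` {v})" by (intro finite_UN_I finite_relpow_Image) auto
  also have "(\<Union>n\<le>r. (parcs G ^^ n) `` {v}) = verts (ball_graph G r v)"
    by (auto simp: verts_ball_graph[OF assms(1)])
  finally show ?thesis .
qed

text \<open>A neighbourhood is split among the finitely many classes \<open>U j\<close>, each
  contributing finitely many neighbours. This supplies the local finiteness of the tree, and hence
  of its balls.\<close>

lemma degree_matrix_for_finite_neighbours:
  assumes "degree_matrix_for t D H" "pair_wf_digraph H" "x \<in> pverts H"
  shows "finite {y. (x, y) \<in> parcs H}"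
proof -
  interpret pair_wf_digraph H by fact
  obtain U where U: "(\<Union>i<t. U i) = pverts H"
      "\<forall>i<t. \<forall>j<t. \<forall>x\<in>U i. finite {y \<in> U j. (x, y) \<in> parcs H}"
    using assms(1) unfolding degree_matrix_for_def by blast
  obtain i where i: "i < t" "x \<in> U i" using U(1) assms(3) by blast
  have "{y. (x, y) \<in> parcs H} \<subseteq> (\<Union>j<t. {y \<in> U j. (x, y) \<in> parcs H})"
    using U(1) by (blast dest: in_arcsD2)
  moreover have "finite (\<Union>j<t. {y \<in> U j. (x, y) \<in> parcs H})" using U(2) i by blast
  ultimately show ?thesis by (rule finite_subset)
qed

section \<open>Comparison of largest eigenvalues along a locally injective map\<close>

lemma sum_matching_le:
  fixes a :: "'a \<Rightarrow> real" and b :: "'b \<Rightarrow> real"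
  assumes "finite A" "finite B"
    and right_unique: "\<And>x y z. x \<in> A \<Longrightarrow> y \<in> B \<Longrightarrow> z \<in> B \<Longrightarrow> R x y \<Longrightarrow> R x z \<Longrightarrow> y = z"
    and left_unique: "\<And>x y z. x \<in> A \<Longrightarrow> y \<in> A \<Longrightarrow> z \<in> B \<Longrightarrow> R x z \<Longrightarrow> R y z \<Longrightarrow> x = y"
  shows "(\<Sum>x\<in>A. \<Sum>y\<in>B. if R x y then a x * b y else 0)
      \<le> sqrt (\<Sum>x\<in>A. (a x)\<^sup>2) * sqrt (\<Sum>y\<in>B. (b y)\<^sup>2)"
proof -
  \<comment> \<open>\<open>E\<close> is the matching as a set of pairs. Uniqueness on either side
    makes both projections injective on \<open>E\<close>, so the squares summed over
    \<open>E\<close> form subsums of those over \<open>A\<close> and \<open>B\<close>.\<close>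
  define E where "E = {e \<in> A \<times> B. R (fst e) (snd e)}"
  have fst_le: "(\<Sum>e\<in>E. (a (fst e))\<^sup>2) \<le> (\<Sum>x\<in>A. (a x)\<^sup>2)"
  proof -
    have "inj_on fst E"
      by (rule inj_onI) (auto simp: E_def dest: right_unique)
    hence "(\<Sum>e\<in>E. (a (fst e))\<^sup>2) = (\<Sum>x\<in>fst ` E. (a x)\<^sup>2)" by (simp add: sum.reindex)
    also have "\<dots> \<le> (\<Sum>x\<in>A. (a x)\<^sup>2)"
      using \<open>finite A\<close> by (intro sum_mono2) (auto simp: E_def)
    finally show ?thesis .
  qed
  have snd_le: "(\<Sum>e\<in>E. (b (snd e))\<^sup>2) \<le> (\<Sum>y\<in>B. (b y)\<^sup>2)"
  proof -
    have "inj_on snd E"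
      by (rule inj_onI) (auto simp: E_def dest: left_unique)
    hence "(\<Sum>e\<in>E. (b (snd e))\<^sup>2) = (\<Sum>y\<in>snd ` E. (b y)\<^sup>2)" by (simp add: sum.reindex)
    also have "\<dots> \<le> (\<Sum>y\<in>B. (b y)\<^sup>2)"
      using \<open>finite B\<close> by (intro sum_mono2) (auto simp: E_def)
    finally show ?thesis .
  qed
  have "(\<Sum>x\<in>A. \<Sum>y\<in>B. if R x y then a x * b y else 0)
      = (\<Sum>e\<in>A \<times> B. if R (fst e) (snd e) then a (fst e) * b (snd e) else 0)"
    by (simp add: sum.cartesian_product case_prod_unfold)
  also have "\<dots> = (\<Sum>e\<in>E. a (fst e) * b (snd e))"
    unfolding E_def using assms by (intro sum.inter_filter[symmetric]) simp
  finally have form: "(\<Sum>x\<in>A. \<Sum>y\<in>B. if R x y then a x * b y else 0)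
      = (\<Sum>e\<in>E. a (fst e) * b (snd e))" .
  have "(\<Sum>e\<in>E. a (fst e) * b (snd e))\<^sup>2 \<le> (\<Sum>e\<in>E. (a (fst e))\<^sup>2) * (\<Sum>e\<in>E. (b (snd e))\<^sup>2)"
    by (rule Cauchy_Schwarz_ineq_sum)
  also have "\<dots> \<le> (\<Sum>x\<in>A. (a x)\<^sup>2) * (\<Sum>y\<in>B. (b y)\<^sup>2)"
    using fst_le snd_le by (intro mult_mono) (auto intro: sum_nonneg)
  finally show ?thesis
    by (simp add: form real_le_rsqrt flip: real_sqrt_mult)
qed

text \<open>Isolates the comparison for finite graphs, to be applied to the two balls with \<pi> as
  \<open>h\<close>. Local injectivity is assumed for outgoing arcs; symmetry of \<open>K\<close>
  gives it for incoming ones.\<close>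

lemma graph_rho_mono_locally_injective:
  fixes H :: "('a, 'c) pre_digraph" and K :: "('b, 'd) pre_digraph" and h :: "'b \<Rightarrow> 'a"
  assumes finH: "finite (verts H)" and finK: "finite (verts K)" and ne: "verts K \<noteq> {}"
    and symH: "\<And>u w. u \<rightarrow>\<^bsub>H\<^esub> w \<Longrightarrow> w \<rightarrow>\<^bsub>H\<^esub> u"
    and symK: "\<And>x y. x \<rightarrow>\<^bsub>K\<^esub> y \<Longrightarrow> y \<rightarrow>\<^bsub>K\<^esub> x"
    and verts: "h ` verts K \<subseteq> verts H"
    and arcs: "\<And>x y. x \<rightarrow>\<^bsub>K\<^esub> y \<Longrightarrow> h x \<rightarrow>\<^bsub>H\<^esub> h y"
    and inj: "\<And>x y z. x \<rightarrow>\<^bsub>K\<^esub> y \<Longrightarrow> x \<rightarrow>\<^bsub>K\<^esub> z \<Longrightarrow> h y = h z \<Longrightarrow> y = z"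
  shows "graph_rho K \<le> graph_rho H"
proof -
  have neH: "verts H \<noteq> {}" using ne verts by auto
  define F where "F u = {x \<in> verts K. h x = u}" for u
  have finF: "finite (F u)" for u using finK by (simp add: F_def)
  obtain f where f: "0 < (\<Sum>x\<in>verts K. (f x)\<^sup>2)"
      "arc_form K f = graph_rho K * (\<Sum>x\<in>verts K. (f x)\<^sup>2)"
    using graph_rho_attained[OF finK ne symK] by blast
  define g where "g u = sqrt (\<Sum>x\<in>F u. (f x)\<^sup>2)" for u
  \<comment> \<open>The fibres over \<open>verts H\<close> partition \<open>verts K\<close>. Those
    over vertices outside the image are empty, and there \<open>g\<close> is 0.\<close>
  have fibres: "(\<Sum>x\<in>verts K. k x) = (\<Sum>u\<in>verts H. \<Sum>x\<in>F u. k x)" for k :: "'b \<Rightarrow> real"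
    unfolding F_def by (rule sum.group[OF finK finH verts, symmetric])
  have norm: "(\<Sum>u\<in>verts H. (g u)\<^sup>2) = (\<Sum>x\<in>verts K. (f x)\<^sup>2)"
    by (simp add: fibres g_def sum_nonneg)
  have block: "(\<Sum>x\<in>F u. \<Sum>y\<in>F w. if x \<rightarrow>\<^bsub>K\<^esub> y then \<bar>f x\<bar> * \<bar>f y\<bar> else 0)
      \<le> (if u \<rightarrow>\<^bsub>H\<^esub> w then g u * g w else 0)" for u w
  proof (cases "u \<rightarrow>\<^bsub>H\<^esub> w")
    case True
    have "(\<Sum>x\<in>F u. \<Sum>y\<in>F w. if x \<rightarrow>\<^bsub>K\<^esub> y then \<bar>f x\<bar> * \<bar>f y\<bar> else 0)
        \<le> sqrt (\<Sum>x\<in>F u. \<bar>f x\<bar>\<^sup>2) * sqrt (\<Sum>y\<in>F w. \<bar>f y\<bar>\<^sup>2)"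
    proof (rule sum_matching_le[OF finF finF])
      fix x y z assume "y \<in> F w" "z \<in> F w" "x \<rightarrow>\<^bsub>K\<^esub> y" "x \<rightarrow>\<^bsub>K\<^esub> z"
      thus "y = z" using inj[of x y z] by (simp add: F_def)
    next
      \<comment> \<open>After reversing both arcs this is local injectivity at
        \<open>z\<close>.\<close>
      fix x y z assume "x \<in> F u" "y \<in> F u" "x \<rightarrow>\<^bsub>K\<^esub> z" "y \<rightarrow>\<^bsub>K\<^esub> z"
      thus "x = y" using inj[of z x y] symK by (simp add: F_def)
    qed
    thus ?thesis using True by (simp add: g_def)
  next
    case False
    \<comment> \<open>Arcs map to arcs, so no arc of \<open>K\<close> lies over a non-arc and the
      whole block vanishes.\<close>
    hence "\<not> x \<rightarrow>\<^bsub>K\<^esub> y" if "x \<in> F u" "y \<in> F w" for x y using that arcs by (auto simp: F_def)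
    thus ?thesis using False by simp
  qed
  have "graph_rho K * (\<Sum>x\<in>verts K. (f x)\<^sup>2) = arc_form K f" using f by simp
  \<comment> \<open>Adjacency entries are nonnegative, so absolute values can only increase the
    form; the norm is unchanged.\<close>
  also have "\<dots> \<le> arc_form K (\<lambda>x. \<bar>f x\<bar>)"
    unfolding arc_form_def by (intro sum_mono) (auto simp flip: abs_mult)
  also have "\<dots> = (\<Sum>u\<in>verts H. \<Sum>x\<in>F u. \<Sum>w\<in>verts H. \<Sum>y\<in>F w.
      if x \<rightarrow>\<^bsub>K\<^esub> y then \<bar>f x\<bar> * \<bar>f y\<bar> else 0)"
    by (simp only: arc_form_def fibres)
  also have "\<dots> = (\<Sum>u\<in>verts H. \<Sum>w\<in>verts H. \<Sum>x\<in>F u. \<Sum>y\<in>F w.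
      if x \<rightarrow>\<^bsub>K\<^esub> y then \<bar>f x\<bar> * \<bar>f y\<bar> else 0)"
    by (intro sum.cong sum.swap refl)
  also have "\<dots> \<le> arc_form H g"
    unfolding arc_form_def by (intro sum_mono block)
  also have "\<dots> \<le> graph_rho H * (\<Sum>x\<in>verts K. (f x)\<^sup>2)"
    using arc_form_le_graph_rho[OF finH neH symH, of g] by (simp add: norm)
  finally show ?thesis using f(1) by simp
qed

theorem theorem2p2:
  fixes t r :: nat
    and D :: "nat mat"
    and G :: "'a pair_pre_digraph"
    and T :: "'b pair_pre_digraph"
    and \<pi> :: "'b \<Rightarrow> 'a"
    and v :: 'a
    and s :: 'b
  assumes "degree_matrix t D"
    and "locally_finite_graph G"
    and "subdegree_matrix t D G"
    and "universal_cover t D T"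
    and "subuniversal_projection \<pi> T G"
    and "v \<in> pverts G"
    and "s \<in> pverts T"
    and "\<pi> s = v"
  shows "graph_rho (ball_graph G r v) \<ge> graph_rho (ball_graph T r s)"
proof -
  interpret G: pair_bidirected_digraph G using assms(2) by (simp add: locally_finite_graph_def)
  interpret T: pair_bidirected_digraph T
    using assms(4) by (simp add: universal_cover_def undirected_tree_def)
  have hom: "(\<pi> x, \<pi> y) \<in> parcs G" if "(x, y) \<in> parcs T" for x y
    using assms(5) that by (auto simp: subuniversal_projection_def graph_hom_def)
  \<comment> \<open>Two arcs with the same tail have images with the same tail, so injectivity on
    arcs becomes injectivity on neighbours.\<close>
  have inj: "y = z" if "(x, y) \<in> parcs T" "(x, z) \<in> parcs T" "\<pi> y = \<pi> z" for x y z
  proof -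
    have "inj_on (map_prod \<pi> \<pi>) (out_arcs (with_proj T) x)"
      using assms(5) T.in_arcsD1[OF that(1)] by (simp add: subuniversal_projection_def)
    from inj_onD[OF this, of "(x, y)" "(x, z)"] that show ?thesis by simp
  qed
  \<comment> \<open>Walks map to walks of the same length, so \<pi> does not increase distances and
    sends the ball around \<open>s\<close> into the ball around \<open>v\<close>.\<close>
  have walk: "(\<pi> x, \<pi> y) \<in> parcs G ^^ n" if "(x, y) \<in> parcs T ^^ n" for x y n
    using that by (induction n arbitrary: y) (auto dest: hom)
  have finG: "finite {y. (x, y) \<in> parcs G}" if "x \<in> pverts G" for x
  proof -
    have "finite (out_arcs (with_proj G) x)" using assms(2) that by (simp add: locally_finite_graph_def)
    hence "finite (snd ` out_arcs (with_proj G) x)" by (rule finite_imageI)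
    also have "snd ` out_arcs (with_proj G) x = {y. (x, y) \<in> parcs G}" by (force simp: out_arcs_def)
    finally show ?thesis .
  qed
  have finT: "finite {y. (x, y) \<in> parcs T}" if "x \<in> pverts T" for x
    using degree_matrix_for_finite_neighbours[OF _ T.pair_wf_digraph_axioms that] assms(4)
    by (auto simp: universal_cover_def)
  have verts: "\<pi> ` verts (ball_graph T r s) \<subseteq> verts (ball_graph G r v)"
    using walk assms(8)
    by (auto simp: T.verts_ball_graph[OF assms(7)] G.verts_ball_graph[OF assms(6)])
  have "s \<in> verts (ball_graph T r s)"
    by (auto simp: T.verts_ball_graph[OF assms(7)] intro!: exI[of _ 0])
  hence ne: "verts (ball_graph T r s) \<noteq> {}" by blast
  have symG: "(w, u) \<in> parcs G" if "(u, w) \<in> parcs G" for u w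
    using symD[OF G.pair_sym_arcs[unfolded symmetric_def]] that by simp
  have symT: "(y, x) \<in> parcs T" if "(x, y) \<in> parcs T" for x y
    using symD[OF T.pair_sym_arcs[unfolded symmetric_def]] that by simp
  show ?thesis
  proof (rule graph_rho_mono_locally_injective[OF _ _ ne _ _ verts])
    show "finite (verts (ball_graph G r v))" by (rule G.finite_ball_graph[OF assms(6) finG])
    show "finite (verts (ball_graph T r s))" by (rule T.finite_ball_graph[OF assms(7) finT])
    show "w \<rightarrow>\<^bsub>ball_graph G r v\<^esub> u" if "u \<rightarrow>\<^bsub>ball_graph G r v\<^esub> w" for u w
      using that symG unfolding arc_ball_graph_iff by blast
    show "y \<rightarrow>\<^bsub>ball_graph T r s\<^esub> x" if "x \<rightarrow>\<^bsub>ball_graph T r s\<^esub> y" for x y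
      using that symT unfolding arc_ball_graph_iff by blast
    show "\<pi> x \<rightarrow>\<^bsub>ball_graph G r v\<^esub> \<pi> y" if "x \<rightarrow>\<^bsub>ball_graph T r s\<^esub> y" for x y
      using that hom verts unfolding arc_ball_graph_iff by blast
    show "y = z" if "x \<rightarrow>\<^bsub>ball_graph T r s\<^esub> y" "x \<rightarrow>\<^bsub>ball_graph T r s\<^esub> z" "\<pi> y = \<pi> z" for x y z
      using that inj unfolding arc_ball_graph_iff by blast
  qed
qed

end
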